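(* For every $d\ge1$ there is a constant $C_d>0$ depending only on $d$ such that the following holds. Let $n\ge1$. Suppose that $X$ is uniformly distributed on $[0,1]^d$, that $(X,Y),(X_1,Y_1),\dots,(X_n,Y_n)$ are i.i.d., that $\varepsilon=Y-g(X)$ is sub-Gaussian conditionally on $X$ with parameter $\sigma^2$, and that $g(x)=\sum_{k=1}^dx_k$. Consider a local map $\mathcal V$ such that $\mathcal V(0)=\prod_{k=1}^d[0,h_k]$ for some deterministic side lengths $h_k$, and let $\bar\gamma$ be such that $\mathrm{diam}(\mathcal V(0))^d/\lambda(\mathcal V(0))\ge\bar\gamma$. Whenever $2^{d+4}\log(2)\le n\prod_{k=1}^dh_k$, we have $$\mathbb E\left[(\hat g_{\mathcal V}(0)-g(0))^2\right]^{1/2}\ge C_d\left(\frac{\bar\gamma\,\sigma^2}{n}\right)^{1/(d+2)}.$$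
   Context: Setting: $(X,Y)$ is a random vector in $\mathbb R^d\times\mathbb R$, $X$ takes values in $S_X=[0,1]^d$, $g(x)=\mathbb E[Y\mid X=x]$, $\varepsilon=Y-g(X)$. Sub-Gaussian conditionally on $X$ with parameter $\sigma^2$: $\mathbb E[\varepsilon\mid X]=0$ and $\mathbb E[\exp(t\varepsilon)\mid X]\le\exp(t^2\sigma^2/2)$ a.s. for all $t\in\mathbb R$. A local map is a mapping $\mathcal V:S_X\to\mathcal B(S_X)$ (Borel subsets of $S_X$) with $x\in\mathcal V(x)$ for all $x\in S_X$ and every $\mathcal V(x)$ of positive Lebesgue measure. The associated estimator is $$\hat g_{\mathcal V}(x)=\frac{\sum_{i=1}^nY_i\mathbf 1_{\mathcal V(x)}(X_i)}{\sum_{i=1}^n\mathbf 1_{\mathcal V(x)}(X_i)},\qquad 0/0=0.$$ $\lambda$ is Lebesgue measure on $\mathbb R^d$ and $\mathrm{diam}(V)=\sup_{x,y\in V}\|x-y\|_2$.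
   Formalization: The formal statement also assumes E[ε²]=σ² (σ² is the noise variance): otherwise ε=0, sub-Gaussian with every σ², violates the bound as σ→∞. The random variables live on a fixed sample space of sequences in R^d×R, which carries every joint law of the pairs. *)

theory Defs
  imports "HOL-Probability.Probability"
begin

definition unit_cube :: "(real ^ 'd) set" where
  "unit_cube = cbox 0 1"

text \<open>
  The sub-\<open>\<sigma>\<close>-algebra generated by \<open>X\<close>; conditioning on \<open>X\<close> means conditioning on it.
\<close>

definition gen_by :: "'w measure \<Rightarrow> ('w \<Rightarrow> 'a::topological_space) \<Rightarrow> 'w measure" where
  "gen_by M X = vimage_algebra (space M) X borel"

definition iid_vars :: "'w measure \<Rightarrow> (nat \<Rightarrow> 'w \<Rightarrow> 'a::topological_space) \<Rightarrow> nat set \<Rightarrow> bool" where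
  "iid_vars M Z I \<longleftrightarrow>
     prob_space.indep_vars M (\<lambda>_. borel) Z I \<and>
     (\<forall>i\<in>I. \<forall>j\<in>I. distr M borel (Z i) = distr M borel (Z j))"

text \<open>
  \<open>g\<close> is a version of \<open>x \<mapsto> E[Y | X = x]\<close>. It is determined only up to null sets of the law of
  \<open>X\<close>, so it is a parameter of a predicate and not the value of a function.
\<close>

definition regression_function ::
    "'w measure \<Rightarrow> ('w \<Rightarrow> 'a::topological_space) \<Rightarrow> ('w \<Rightarrow> real) \<Rightarrow> ('a \<Rightarrow> real) \<Rightarrow> bool" where
  "regression_function M X Y g \<longleftrightarrow>
     integrable M Y \<and> g \<in> borel_measurable borel \<and>
     (AE \<omega> in M. real_cond_exp M (gen_by M X) Y \<omega> = g (X \<omega>))"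

text \<open>
  The conditional moment generating function is taken in \<^typ>\<open>ennreal\<close>, so that no integrability
  of \<open>exp (t * \<epsilon>)\<close> has to be presupposed. As usual, only the upper bound is required; in
  particular the parameter \<open>s\<close> (which plays the role of \<open>\<sigma>\<^sup>2\<close>) bounds the conditional variance
  from above but need not be equal to it: \<open>\<epsilon> = 0\<close> has every parameter \<open>s \<ge> 0\<close>. A bound of an
  error from below in terms of \<open>\<sigma>\<^sup>2\<close> therefore needs \<open>E[\<epsilon>\<^sup>2] = \<sigma>\<^sup>2\<close> as a hypothesis of its own. Since
  \<open>E[\<epsilon>\<^sup>2 | X] \<le> \<sigma>\<^sup>2\<close> a.s. by the definition below, this is the same as \<open>E[\<epsilon>\<^sup>2 | X] = \<sigma>\<^sup>2\<close> a.s.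
\<close>

definition cond_subgaussian ::
    "'w measure \<Rightarrow> ('w \<Rightarrow> 'a::topological_space) \<Rightarrow> ('w \<Rightarrow> real) \<Rightarrow> real \<Rightarrow> bool" where
  "cond_subgaussian M X \<epsilon> s \<longleftrightarrow>
     integrable M \<epsilon> \<and>
     (AE \<omega> in M. real_cond_exp M (gen_by M X) \<epsilon> \<omega> = 0) \<and>
     (\<forall>t. AE \<omega> in M.
        nn_cond_exp M (gen_by M X) (\<lambda>\<omega>. ennreal (exp (t * \<epsilon> \<omega>))) \<omega> \<le> ennreal (exp (t\<^sup>2 * s / 2)))"

definition local_map :: "(real ^ 'd \<Rightarrow> (real ^ 'd) set) \<Rightarrow> bool" where
  "local_map V \<longleftrightarrow>
     (\<forall>x\<in>unit_cube. V x \<in> sets borel \<and> V x \<subseteq> unit_cube \<and> x \<in> V x \<and> 0 < emeasure lborel (V x))"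

text \<open>
  The data are the pairs \<open>(x\<^sub>i, y\<^sub>i)\<close> with \<open>1 \<le> i \<le> n\<close>; index \<open>0\<close> is not used here and is free to
  carry the generic pair \<open>(X, Y)\<close>. The convention \<open>0/0 = 0\<close> is that of HOL.
\<close>

definition local_estimator ::
    "(real ^ 'd \<Rightarrow> (real ^ 'd) set) \<Rightarrow> nat \<Rightarrow> (nat \<Rightarrow> real ^ 'd) \<Rightarrow> (nat \<Rightarrow> real) \<Rightarrow> real ^ 'd \<Rightarrow> real" where
  "local_estimator V n xs ys x =
     (\<Sum>i=1..n. ys i * indicator (V x) (xs i)) / (\<Sum>i=1..n. indicator (V x) (xs i))"

text \<open>
  A constant that is quantified inside a statement may depend on every type variable of that
  statement. For a constant that depends on the dimension only, the sample space therefore gets a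
  fixed type, which is large enough to carry every sequence of pairs \<open>(X\<^sub>i, Y\<^sub>i)\<close>: the law of such a
  sequence lives on it, with the coordinate maps as random variables.
\<close>

type_synonym 'd sample_space = "nat \<Rightarrow> (real ^ 'd) \<times> real"

end

theory Submission
  imports Defs
begin

text \<open>
  Let \<open>p\<close> be the volume of the box \<open>V(0)\<close>, \<open>a\<close> its diameter, \<open>N\<close> the number of the \<open>X\<^sub>i\<close> in it, and
  \<open>m\<close>, \<open>q\<close> the conditional mean and variance of \<open>Y\<close> given \<open>X \<in> V(0)\<close>. Since \<open>N\<close> equals one plus
  a function of the other observations whenever \<open>X\<^sub>i \<in> V(0)\<close>, independence gives the exact formula
  \<open>E[(estimate at 0)\<^sup>2] = m\<^sup>2 P(N > 0) + q E[1/N; N > 0]\<close>. The squared bias is at least of order \<open>a\<^sup>2\<close>,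
  because \<open>m\<close> is half the sum of the side lengths. The variance is at least of order
  \<open>\<sigma>\<^sup>2 / (n p) \<ge> \<gamma> \<sigma>\<^sup>2 / (n a\<^sup>d)\<close>, because \<open>q \<ge> \<sigma>\<^sup>2\<close>. Minimizing the sum over \<open>a\<close> gives the rate.
\<close>

section \<open>Second moment of a local average of independent observations\<close>

text \<open>Observation \<open>i\<close> and the family of all the others are restrictions of
  \<open>U\<close> to disjoint index sets, hence independent. \<open>F\<close> takes the whole
  family at once, so it may contain a count over the other observations.\<close>

lemma (in prob_space) indep_vars_integral_mult_rest:
  fixes U :: "'i \<Rightarrow> 'a \<Rightarrow> 'b::topological_space" and f :: "'b \<Rightarrow> real" and F :: "('i \<Rightarrow> 'b) \<Rightarrow> real"
  assumes U: "indep_vars (\<lambda>_. borel) U J" and i: "i \<in> J"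
    and [measurable]: "f \<in> borel_measurable borel" "F \<in> borel_measurable (PiM (J - {i}) (\<lambda>_. borel))"
    and int: "integrable M (\<lambda>\<omega>. f (U i \<omega>))" "integrable M (\<lambda>\<omega>. F (\<lambda>j\<in>J - {i}. U j \<omega>))"
  shows "integrable M (\<lambda>\<omega>. f (U i \<omega>) * F (\<lambda>j\<in>J - {i}. U j \<omega>))" (is ?int)
    and "expectation (\<lambda>\<omega>. f (U i \<omega>) * F (\<lambda>j\<in>J - {i}. U j \<omega>)) =
         expectation (\<lambda>\<omega>. f (U i \<omega>)) * expectation (\<lambda>\<omega>. F (\<lambda>j\<in>J - {i}. U j \<omega>))" (is ?eq)
proof -
  have "indep_var borel ((\<lambda>u. f (u i)) \<circ> (\<lambda>\<omega>. \<lambda>j\<in>{i}. U j \<omega>))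
          borel (F \<circ> (\<lambda>\<omega>. \<lambda>j\<in>J - {i}. U j \<omega>))"
    using i by (intro indep_var_compose[OF indep_var_restrict[OF U]]) auto
  then have ind: "indep_var borel (\<lambda>\<omega>. f (U i \<omega>)) borel (\<lambda>\<omega>. F (\<lambda>j\<in>J - {i}. U j \<omega>))"
    by (simp add: comp_def)
  show ?int using indep_var_integrable[OF ind int] .
  show ?eq using indep_var_lebesgue_integral[OF ind int] .
qed

text \<open>The denominator \<open>N\<close> depends on every observation. But a term with
  \<open>U i \<omega> \<notin> A\<close> vanishes, and for \<open>U i \<omega> \<in> A\<close> the
  denominator is one plus the number of hits among the others. So each summand is a function of
  \<open>U i\<close> times a weight independent of \<open>U i\<close>. Centering removes the
  off-diagonal terms of the square, and the weights of the diagonal terms add up to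
  \<open>1 / N\<close>.\<close>

lemma (in prob_space) second_moment_local_average:
  fixes U :: "'i \<Rightarrow> 'a \<Rightarrow> 'b::topological_space" and \<phi> :: "'b \<Rightarrow> real" and m q :: real
  assumes J: "finite J" and U: "indep_vars (\<lambda>_. borel) U J"
    and A[measurable]: "A \<in> sets borel" and \<phi>[measurable]: "\<phi> \<in> borel_measurable borel"
    and zero: "\<And>u. u \<notin> A \<Longrightarrow> \<phi> u = 0"
    and int: "\<And>i. i \<in> J \<Longrightarrow> integrable M (\<lambda>\<omega>. (\<phi> (U i \<omega>))\<^sup>2)"
    and mean: "\<And>i. i \<in> J \<Longrightarrow> expectation (\<lambda>\<omega>. \<phi> (U i \<omega>)) = 0"
    and var: "\<And>i. i \<in> J \<Longrightarrow> expectation (\<lambda>\<omega>. (\<phi> (U i \<omega>))\<^sup>2) = q * expectation (\<lambda>\<omega>. indicator A (U i \<omega>))"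
  defines "N \<equiv> \<lambda>\<omega>. \<Sum>i\<in>J. indicator A (U i \<omega>) :: real"
  shows "expectation (\<lambda>\<omega>. (m * of_bool (N \<omega> \<noteq> 0) + (\<Sum>i\<in>J. \<phi> (U i \<omega>)) / N \<omega>)\<^sup>2) =
    m\<^sup>2 * prob {\<omega>\<in>space M. N \<omega> \<noteq> 0} + q * expectation (\<lambda>\<omega>. 1 / N \<omega>)"
proof -
  have U_meas[measurable]: "\<And>i. i \<in> J \<Longrightarrow> U i \<in> borel_measurable M"
    using U by (auto simp: indep_vars_def)
  have N_meas[measurable]: "N \<in> borel_measurable M"
    unfolding N_def by measurable
  define R where "R i \<omega> = (\<Sum>k\<in>J - {i}. indicator A (U k \<omega>) :: real)" for i \<omega>
  have R_meas[measurable]: "R i \<in> borel_measurable M" for i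
    unfolding R_def by measurable
  have R_nonneg: "R i \<omega> \<ge> 0" for i \<omega> unfolding R_def by (intro sum_nonneg) auto
  have N_eq: "N \<omega> = 1 + R i \<omega>" if "i \<in> J" "U i \<omega> \<in> A" for i \<omega>
    using that J unfolding N_def R_def by (subst sum.remove[of J i]) auto
  \<comment> \<open>\<open>w k i\<close> replaces \<open>1 / N ^ k\<close> in terms that vanish
    unless observation \<open>i\<close> hits \<open>A\<close>. It is built from the other
    observations only, hence independent of \<open>U i\<close>, and it is bounded because
    \<open>R i\<close> is nonnegative.\<close>
  define w where "w k i \<omega> = 1 / (1 + R i \<omega>) ^ k" for k :: nat and i \<omega>
  have w_bd: "\<bar>w k i \<omega>\<bar> \<le> 1" for k i \<omega>
    using R_nonneg[of i \<omega>] by (auto simp: w_def divide_le_eq)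
  have w_meas[measurable]: "w k i \<in> borel_measurable M" for k i
    unfolding w_def by measurable
  have w_int: "integrable M (w k i)" for k i
    by (rule integrable_const_bound[of _ 1]) (auto simp: w_bd)
  have \<phi>_w: "\<phi> (U i \<omega>) / N \<omega> ^ k = \<phi> (U i \<omega>) * w k i \<omega>" if "i \<in> J" for i k \<omega>
    using N_eq[OF that, of \<omega>] zero[of "U i \<omega>"] by (cases "U i \<omega> \<in> A") (auto simp: w_def)
  have I_w: "indicator A (U i \<omega>) / N \<omega> ^ k = indicator A (U i \<omega>) * w k i \<omega>" if "i \<in> J" for i k \<omega>
    using N_eq[OF that, of \<omega>] by (cases "U i \<omega> \<in> A") (auto simp: w_def)
  have int1: "integrable M (\<lambda>\<omega>. \<phi> (U i \<omega>))" if "i \<in> J" for i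
    using square_integrable_imp_integrable[OF _ int[OF that]] that by simp
  \<comment> \<open>The same weight as a function on the product space of the other observations,
    which is the form that the factorization above asks for.\<close>
  define W where "W k i u = 1 / (1 + (\<Sum>l\<in>J - {i}. indicator A (u l) :: real)) ^ k" for k :: nat and i and u :: "'i \<Rightarrow> 'b"
  have W_meas[measurable]: "W k i \<in> borel_measurable (PiM (J - {i}) (\<lambda>_. borel))" for k i
    unfolding W_def by measurable
  have w_W: "w k i \<omega> = W k i (\<lambda>j\<in>J - {i}. U j \<omega>)" for k i \<omega>
    unfolding w_def W_def R_def by simp
  have split: "integrable M (\<lambda>\<omega>. f (U i \<omega>) * w k i \<omega>)"
      "expectation (\<lambda>\<omega>. f (U i \<omega>) * w k i \<omega>) = expectation (\<lambda>\<omega>. f (U i \<omega>)) * expectation (w k i)"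
    if "i \<in> J" "f \<in> borel_measurable borel" "integrable M (\<lambda>\<omega>. f (U i \<omega>))" for f :: "'b \<Rightarrow> real" and i k
    using indep_vars_integral_mult_rest[OF U that(1,2) W_meas that(3), of k] w_int[of k i]
    by (simp_all add: w_W[abs_def])
  \<comment> \<open>The weight contains \<open>U j\<close>, so it cannot be separated from
    \<open>\<phi> (U j \<omega>)\<close>. Their product still depends only on observations other
    than \<open>i\<close>, so the centered factor \<open>\<phi> (U i \<omega>)\<close> splits
    off.\<close>
  have split2: "expectation (\<lambda>\<omega>. \<phi> (U i \<omega>) * (\<phi> (U j \<omega>) * w k i \<omega>)) = 0"
      "integrable M (\<lambda>\<omega>. \<phi> (U i \<omega>) * (\<phi> (U j \<omega>) * w k i \<omega>))"
    if "i \<in> J" "j \<in> J" "i \<noteq> j" for i j k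
  proof -
    have bd: "integrable M (\<lambda>\<omega>. \<phi> (U j \<omega>) * w k i \<omega>)"
      by (rule Bochner_Integration.integrable_bound[OF int1[OF that(2)]])
         (use that w_bd in \<open>auto simp: abs_mult intro!: mult_left_le\<close>)
    have j: "j \<in> J - {i}" using that by auto
    then have [measurable]: "(\<lambda>u. \<phi> (u j) * W k i u) \<in> borel_measurable (PiM (J - {i}) (\<lambda>_. borel))"
      by measurable
    show "expectation (\<lambda>\<omega>. \<phi> (U i \<omega>) * (\<phi> (U j \<omega>) * w k i \<omega>)) = 0"
      "integrable M (\<lambda>\<omega>. \<phi> (U i \<omega>) * (\<phi> (U j \<omega>) * w k i \<omega>))"
      using indep_vars_integral_mult_rest[OF U that(1) \<phi>, of "\<lambda>u. \<phi> (u j) * W k i u"] int1[OF that(1)] bd j mean[OF that(1)]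
      by (simp_all add: w_W[abs_def])
  qed
  define T where "T \<omega> = (\<Sum>i\<in>J. \<phi> (U i \<omega>)) / N \<omega>" for \<omega>
  have T_eq: "T \<omega> = (\<Sum>i\<in>J. \<phi> (U i \<omega>) * w 1 i \<omega>)" for \<omega>
    unfolding T_def sum_divide_distrib by (intro sum.cong refl) (use \<phi>_w[of _ \<omega> 1] in simp)
  have T0: "T \<omega> = 0" if "N \<omega> = 0" for \<omega> using that by (simp add: T_def)
  have T_int: "integrable M T" "expectation T = 0"
    unfolding T_eq[abs_def] using split[OF _ \<phi> int1] mean by (simp_all add: Bochner_Integration.integral_sum)
  \<comment> \<open>In each product the whole factor \<open>1 / (N \<omega>)\<^sup>2\<close> is
    assigned to index \<open>i\<close>, which brings the off-diagonal terms into the shape of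
    \<open>split2\<close>.\<close>
  have T2_eq: "(T \<omega>)\<^sup>2 = (\<Sum>i\<in>J. (\<phi> (U i \<omega>))\<^sup>2 * w 2 i \<omega>) +
      (\<Sum>i\<in>J. \<Sum>j\<in>J - {i}. \<phi> (U i \<omega>) * (\<phi> (U j \<omega>) * w 2 i \<omega>))" for \<omega>
  proof -
    have "(T \<omega>)\<^sup>2 = (\<Sum>i\<in>J. \<Sum>j\<in>J. \<phi> (U j \<omega>) * (\<phi> (U i \<omega>) / (N \<omega>)\<^sup>2))"
      unfolding T_def power_divide power2_eq_square[of "sum _ _"] sum_product sum_divide_distrib
      by (intro sum.cong refl) (simp add: power2_eq_square)
    also have "\<dots> = (\<Sum>i\<in>J. \<Sum>j\<in>J. \<phi> (U j \<omega>) * (\<phi> (U i \<omega>) * w 2 i \<omega>))"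
      by (intro sum.cong refl) (simp add: \<phi>_w)
    also have "\<dots> = (\<Sum>i\<in>J. (\<phi> (U i \<omega>))\<^sup>2 * w 2 i \<omega> + (\<Sum>j\<in>J - {i}. \<phi> (U i \<omega>) * (\<phi> (U j \<omega>) * w 2 i \<omega>)))"
      using J by (intro sum.cong refl, subst sum.remove) (auto simp: power2_eq_square mult_ac)
    finally show ?thesis by (simp add: sum.distrib)
  qed
  have int_diag: "integrable M (\<lambda>\<omega>. (\<phi> (U i \<omega>))\<^sup>2 * w 2 i \<omega>)" if "i \<in> J" for i
    using split(1)[OF that _ int[OF that], of 2] by simp
  have I_int: "integrable M (\<lambda>\<omega>. indicator A (U i \<omega>) :: real)" if "i \<in> J" for i
    by (rule integrable_const_bound[of _ 1]) (use that in \<open>auto simp: indicator_def\<close>)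
  have I_w_int: "integrable M (\<lambda>\<omega>. indicator A (U i \<omega>) * w 2 i \<omega>)" if "i \<in> J" for i
    using split(1)[OF that _ I_int[OF that], of 2] by simp
  have diag: "expectation (\<lambda>\<omega>. (\<phi> (U i \<omega>))\<^sup>2 * w 2 i \<omega>) =
      q * expectation (\<lambda>\<omega>. indicator A (U i \<omega>) * w 2 i \<omega>)" if "i \<in> J" for i
    using split(2)[OF that _ int[OF that], of 2] split(2)[OF that _ I_int[OF that], of 2] var[OF that] by simp
  have T2_int: "integrable M (\<lambda>\<omega>. (T \<omega>)\<^sup>2)"
    unfolding T2_eq by (intro Bochner_Integration.integrable_add Bochner_Integration.integrable_sum int_diag split2) auto
  have "expectation (\<lambda>\<omega>. (T \<omega>)\<^sup>2) = (\<Sum>i\<in>J. expectation (\<lambda>\<omega>. (\<phi> (U i \<omega>))\<^sup>2 * w 2 i \<omega>)) +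
      (\<Sum>i\<in>J. \<Sum>j\<in>J - {i}. expectation (\<lambda>\<omega>. \<phi> (U i \<omega>) * (\<phi> (U j \<omega>) * w 2 i \<omega>)))"
  proof -
    have off: "integrable M (\<lambda>\<omega>. \<phi> (U i \<omega>) * (\<phi> (U j \<omega>) * w 2 i \<omega>))" if "i \<in> J" "j \<in> J - {i}" for i j
      using split2(2)[of i j] that by auto
    show ?thesis
      unfolding T2_eq by (subst Bochner_Integration.integral_add)
        (intro Bochner_Integration.integrable_sum int_diag off arg_cong2[where f="(+)"] sum.cong refl
          Bochner_Integration.integral_sum[THEN trans]; assumption)+
  qed
  also have "\<dots> = (\<Sum>i\<in>J. q * expectation (\<lambda>\<omega>. indicator A (U i \<omega>) * w 2 i \<omega>))"
    using split2(1) by (simp add: diag) (intro sum.neutral ballI, auto)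
  also have "\<dots> = q * expectation (\<lambda>\<omega>. \<Sum>i\<in>J. indicator A (U i \<omega>) * w 2 i \<omega>)"
    by (subst Bochner_Integration.integral_sum) (auto simp: sum_distrib_left I_w_int)
  \<comment> \<open>Back from the weights to the count: the sum is \<open>N / N\<^sup>2\<close>.
    This is \<open>1 / N\<close> also for \<open>N = 0\<close>, where both are 0 by the convention
    for division.\<close>
  also have "(\<lambda>\<omega>. \<Sum>i\<in>J. indicator A (U i \<omega>) * w 2 i \<omega>) = (\<lambda>\<omega>. 1 / N \<omega>)"
  proof
    fix \<omega>
    have "(\<Sum>i\<in>J. indicator A (U i \<omega>) * w 2 i \<omega>) = (\<Sum>i\<in>J. indicator A (U i \<omega>) / (N \<omega>)\<^sup>2)"
      by (intro sum.cong refl) (simp add: I_w)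
    also have "\<dots> = N \<omega> / (N \<omega>)\<^sup>2"
      by (simp add: N_def sum_divide_distrib)
    finally have "(\<Sum>i\<in>J. indicator A (U i \<omega>) * w 2 i \<omega>) = N \<omega> / (N \<omega>)\<^sup>2" .
    then show "(\<Sum>i\<in>J. indicator A (U i \<omega>) * w 2 i \<omega>) = 1 / N \<omega>"
      by (simp add: power2_eq_square)
  qed
  finally have ET2: "expectation (\<lambda>\<omega>. (T \<omega>)\<^sup>2) = q * expectation (\<lambda>\<omega>. 1 / N \<omega>)" .
  \<comment> \<open>As \<open>T\<close> vanishes wherever \<open>N\<close> does, the mixed term
    carries no indicator and drops out because \<open>T\<close> has mean zero.\<close>
  have "(m * of_bool (N \<omega> \<noteq> 0) + T \<omega>)\<^sup>2 =
      m\<^sup>2 * indicator {\<omega>\<in>space M. N \<omega> \<noteq> 0} \<omega> + 2 * m * T \<omega> + (T \<omega>)\<^sup>2" if "\<omega> \<in> space M" for \<omega>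
    using T0[of \<omega>] that by (cases "N \<omega> = 0") (auto simp: power2_eq_square algebra_simps)
  then have "expectation (\<lambda>\<omega>. (m * of_bool (N \<omega> \<noteq> 0) + T \<omega>)\<^sup>2) =
      expectation (\<lambda>\<omega>. m\<^sup>2 * indicator {\<omega>\<in>space M. N \<omega> \<noteq> 0} \<omega> + 2 * m * T \<omega> + (T \<omega>)\<^sup>2)"
    by (intro Bochner_Integration.integral_cong) auto
  also have "\<dots> = m\<^sup>2 * prob {\<omega>\<in>space M. N \<omega> \<noteq> 0} + q * expectation (\<lambda>\<omega>. 1 / N \<omega>)"
    using T_int T2_int ET2 by (simp add: emeasure_eq_measure)
  finally show ?thesis unfolding T_def .
qed

section \<open>Number of observations in a cell\<close>

text \<open>By independence the probability of no hit is \<open>(1 - p) ^ card J\<close>, which is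
  at most \<open>exp (- (card J * p))\<close>; the threshold \<open>ln 2\<close> makes this at most
  one half.\<close>

lemma (in prob_space) prob_some_indep_event_ge_half:
  fixes U :: "'i \<Rightarrow> 'a \<Rightarrow> 'b::topological_space"
  assumes J: "finite J" and U: "indep_vars (\<lambda>_. borel) U J" and A[measurable]: "A \<in> sets borel"
    and p: "\<And>i. i \<in> J \<Longrightarrow> expectation (\<lambda>\<omega>. indicator A (U i \<omega>)) = p" and large: "ln 2 \<le> real (card J) * p"
  shows "prob {\<omega>\<in>space M. (\<Sum>i\<in>J. indicator A (U i \<omega>) :: real) \<noteq> 0} \<ge> 1 / 2"
proof -
  have U_meas[measurable]: "\<And>i. i \<in> J \<Longrightarrow> U i \<in> borel_measurable M"
    using U by (auto simp: indep_vars_def)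
  have I_int: "integrable M (\<lambda>\<omega>. indicator A (U i \<omega>) :: real)" if "i \<in> J" for i
    by (rule integrable_const_bound[of _ 1]) (use that in \<open>auto simp: indicator_def\<close>)
  have "J \<noteq> {}" using large by auto
  \<comment> \<open>This makes the base \<open>1 - p\<close> nonnegative, as the comparison of
    powers with \<open>exp (- p)\<close> requires.\<close>
  have p1: "p \<le> 1"
  proof -
    obtain i where i: "i \<in> J" using \<open>J \<noteq> {}\<close> by auto
    have "expectation (\<lambda>\<omega>. indicator A (U i \<omega>) :: real) \<le> expectation (\<lambda>\<omega>. 1)"
      using I_int[OF i] by (intro integral_mono) (auto simp: indicator_def)
    then show ?thesis using p[OF i] by (simp add: prob_space)
  qed
  have ind: "indep_vars (\<lambda>_. borel) (\<lambda>i \<omega>. 1 - indicator A (U i \<omega>) :: real) J"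
    by (rule indep_vars_compose2[OF U]) auto
  have "prob {\<omega>\<in>space M. (\<Sum>i\<in>J. indicator A (U i \<omega>) :: real) = 0} =
      expectation (\<lambda>\<omega>. indicator {\<omega>\<in>space M. (\<Sum>i\<in>J. indicator A (U i \<omega>) :: real) = 0} \<omega>)"
    by simp
  also have "\<dots> = expectation (\<lambda>\<omega>. \<Prod>i\<in>J. 1 - indicator A (U i \<omega>))"
  proof (intro Bochner_Integration.integral_cong refl)
    fix \<omega> assume w: "\<omega> \<in> space M"
    show "indicator {\<omega>\<in>space M. (\<Sum>i\<in>J. indicator A (U i \<omega>) :: real) = 0} \<omega> = (\<Prod>i\<in>J. 1 - indicator A (U i \<omega>) :: real)"
    proof (cases "\<exists>i\<in>J. U i \<omega> \<in> A")
      case True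
      then obtain i where "i \<in> J" "U i \<omega> \<in> A" by auto
      then have "(\<Sum>i\<in>J. indicator A (U i \<omega>) :: real) \<noteq> 0" "(\<Prod>i\<in>J. 1 - indicator A (U i \<omega>) :: real) = 0"
        using J by (auto simp: sum_nonneg_eq_0_iff intro!: bexI[of _ i])
      then show ?thesis by simp
    next
      case False
      then show ?thesis using w by (auto intro!: prod.neutral[symmetric])
    qed
  qed
  also have "\<dots> = (\<Prod>i\<in>J. expectation (\<lambda>\<omega>. 1 - indicator A (U i \<omega>)))"
    using J ind I_int by (intro indep_vars_lebesgue_integral) auto
  also have "\<dots> = (1 - p) ^ card J"
    using p I_int by (simp add: prob_space)
  also have "\<dots> \<le> exp (- p) ^ card J"
    using p1 exp_ge_add_one_self[of "-p"] by (intro power_mono) auto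
  also have "\<dots> = exp (- (real (card J) * p))"
    by (simp add: exp_of_nat_mult[symmetric])
  also have "\<dots> \<le> exp (- ln 2)" using large by simp
  also have "\<dots> = 1 / 2" by (simp add: exp_minus)
  finally have "prob {\<omega>\<in>space M. (\<Sum>i\<in>J. indicator A (U i \<omega>) :: real) = 0} \<le> 1 / 2" .
  moreover have "prob {\<omega>\<in>space M. (\<Sum>i\<in>J. indicator A (U i \<omega>) :: real) \<noteq> 0} =
      1 - prob {\<omega>\<in>space M. (\<Sum>i\<in>J. indicator A (U i \<omega>) :: real) = 0}"
    by (rule prob_neg) measurable
  ultimately show ?thesis by linarith
qed

text \<open>Jensen's inequality does not apply directly, since \<open>1 / N\<close> is 0 at
  \<open>N = 0\<close>. Instead a tangent to \<open>1 / x\<close> at a point \<open>c\<close> is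
  used on \<open>N \<noteq> 0\<close>, an event of probability at least one half; it yields the
  bound \<open>1 / c - \<mu> / c\<^sup>2\<close>, where \<open>\<mu>\<close> is the mean of
  \<open>N\<close>. The choice \<open>c = 2 * \<mu>\<close> maximizes this and gives
  \<open>1 / (4 * \<mu>)\<close>.\<close>

lemma (in prob_space) expectation_inverse_count_ge:
  fixes U :: "'i \<Rightarrow> 'a \<Rightarrow> 'b::topological_space"
  assumes J: "finite J" and U: "indep_vars (\<lambda>_. borel) U J" and A[measurable]: "A \<in> sets borel"
    and p: "\<And>i. i \<in> J \<Longrightarrow> expectation (\<lambda>\<omega>. indicator A (U i \<omega>)) = p" and large: "ln 2 \<le> real (card J) * p"
  shows "expectation (\<lambda>\<omega>. 1 / (\<Sum>i\<in>J. indicator A (U i \<omega>))) \<ge> 1 / (4 * (real (card J) * p))"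
proof -
  define N where "N \<omega> = (\<Sum>i\<in>J. indicator A (U i \<omega>) :: real)" for \<omega>
  define \<mu> where "\<mu> = real (card J) * p"
  have \<mu>: "\<mu> > 0" using large ln_gt_zero[of "2::real"] unfolding \<mu>_def by linarith
  have U_meas[measurable]: "\<And>i. i \<in> J \<Longrightarrow> U i \<in> borel_measurable M"
    using U by (auto simp: indep_vars_def)
  have N_meas[measurable]: "N \<in> borel_measurable M"
    unfolding N_def by measurable
  have I_int: "integrable M (\<lambda>\<omega>. indicator A (U i \<omega>) :: real)" if "i \<in> J" for i
    by (rule integrable_const_bound[of _ 1]) (use that in \<open>auto simp: indicator_def\<close>)
  have N_int: "integrable M N" "expectation N = \<mu>"
    unfolding N_def \<mu>_def using I_int p by (simp_all add: Bochner_Integration.integral_sum)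
  \<comment> \<open>Integrality keeps \<open>1 / N\<close> below one, although \<open>N\<close> may
    come down to 0.\<close>
  have N_nat: "N \<omega> = 0 \<or> N \<omega> \<ge> 1" for \<omega>
  proof -
    have "N \<omega> = real (\<Sum>i\<in>J. indicator A (U i \<omega>))" unfolding N_def by (simp add: indicator_def of_bool_def if_distrib cong: if_cong)
    then show ?thesis by (metis less_one linorder_not_less of_nat_0 of_nat_1 of_nat_le_iff)
  qed
  have inv_int: "integrable M (\<lambda>\<omega>. 1 / N \<omega>)"
  proof (rule integrable_const_bound[of _ 1])
    show "AE \<omega> in M. norm (1 / N \<omega>) \<le> 1"
    proof (rule AE_I2)
      fix \<omega> show "norm (1 / N \<omega>) \<le> 1" using N_nat[of \<omega>] by (auto simp: divide_le_eq)
    qed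
  qed simp
  let ?E = "{\<omega>\<in>space M. N \<omega> \<noteq> 0}"
  have half: "prob ?E \<ge> 1 / 2"
    using prob_some_indep_event_ge_half[OF J U A p large] unfolding N_def by simp
  have "1 / (4 * \<mu>) = (1 / \<mu>) * (1 / 2) - \<mu> / (4 * \<mu>\<^sup>2)"
    using \<mu> by (simp add: field_simps power2_eq_square)
  also have "\<dots> \<le> (1 / \<mu>) * prob ?E - \<mu> / (4 * \<mu>\<^sup>2)"
    using half \<mu> by (intro diff_mono mult_left_mono) auto
  also have "\<dots> = expectation (\<lambda>\<omega>. (1 / \<mu>) * indicator ?E \<omega> - N \<omega> / (4 * \<mu>\<^sup>2))"
    using N_int by (subst Bochner_Integration.integral_diff) (simp_all add: emeasure_eq_measure)
  also have "\<dots> \<le> expectation (\<lambda>\<omega>. 1 / N \<omega>)"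
  proof (intro integral_mono inv_int)
    show "integrable M (\<lambda>\<omega>. (1 / \<mu>) * indicator ?E \<omega> - N \<omega> / (4 * \<mu>\<^sup>2))"
      using N_int by (intro Bochner_Integration.integrable_diff integrable_mult_right integrable_divide)
        (auto simp: emeasure_eq_measure)
    \<comment> \<open>The tangent at \<open>2 * \<mu>\<close> to the convex function \<open>x \<mapsto> 1 / x\<close>.\<close>
    fix \<omega> assume w: "\<omega> \<in> space M"
    show "(1 / \<mu>) * indicator ?E \<omega> - N \<omega> / (4 * \<mu>\<^sup>2) \<le> 1 / N \<omega>"
    proof (cases "N \<omega> = 0")
      case False
      then have pos: "N \<omega> > 0" using N_nat[of \<omega>] by linarith
      have "1 / N \<omega> - (1 / \<mu> - N \<omega> / (4 * \<mu>\<^sup>2)) = (2 * \<mu> - N \<omega>)\<^sup>2 / (4 * \<mu>\<^sup>2 * N \<omega>)"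
        using pos \<mu> by (simp add: field_simps power2_eq_square)
      also have "\<dots> \<ge> 0" using pos by simp
      finally show ?thesis using False w by simp
    qed simp
  qed
  finally show ?thesis unfolding \<mu>_def N_def .
qed

section \<open>Consequences of conditional sub-Gaussianity\<close>

text \<open>All terms of the power series are nonnegative, so it may be cut after degree two. This
  lets symmetrized exponential moments control second moments.\<close>

lemma cosh_ge_quadratic: "1 + x\<^sup>2 / 2 \<le> cosh (x::real)"
proof -
  have "(\<Sum>k<3. if even k then x ^ k /\<^sub>R fact k else 0) \<le> cosh x"
    using sum_le_suminf[OF sums_summable[OF cosh_converges[of x]], of "{..<3}"]
    by (auto simp: sums_unique[OF cosh_converges[of x], symmetric] zero_le_even_power)
  then show ?thesis by (simp add: eval_nat_numeral field_simps)
qed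

lemma (in prob_space) gen_by_subalgebra:
  fixes X :: "'a \<Rightarrow> 'b::topological_space"
  assumes [measurable]: "X \<in> borel_measurable M"
  shows "finite_measure_subalgebra M (gen_by M X)"
proof
  show "subalgebra M (gen_by M X)"
    unfolding subalgebra_def gen_by_def by (auto simp: sets_vimage_algebra2)
qed

lemma measurable_gen_by:
  fixes X :: "'a \<Rightarrow> 'b::topological_space"
  assumes "f \<in> measurable borel N"
  shows "(\<lambda>\<omega>. f (X \<omega>)) \<in> measurable (gen_by M X) N"
  using measurable_compose[OF measurable_vimage_algebra1 assms, of X "space M"] by (simp add: gen_by_def)

text \<open>The conditional bound is integrated over the event that \<open>X\<close> lies in
  \<open>B\<close>. The computation runs in nonnegative integrals, so that integrability follows
  from the finite bound instead of being presupposed.\<close>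

lemma (in prob_space) cond_subgaussian_mgf_on:
  fixes X :: "'a \<Rightarrow> 'b::topological_space"
  assumes X[measurable]: "X \<in> borel_measurable M" and sub: "cond_subgaussian M X \<epsilon> s" and B[measurable]: "B \<in> sets borel"
  shows "integrable M (\<lambda>\<omega>. indicator B (X \<omega>) * exp (t * \<epsilon> \<omega>))" (is ?int)
    and "expectation (\<lambda>\<omega>. indicator B (X \<omega>) * exp (t * \<epsilon> \<omega>)) \<le> exp (t\<^sup>2 * s / 2) * prob {\<omega>\<in>space M. X \<omega> \<in> B}" (is ?le)
proof -
  interpret F: finite_measure_subalgebra M "gen_by M X" by (rule gen_by_subalgebra[OF X])
  have [measurable]: "\<epsilon> \<in> borel_measurable M" using sub by (auto simp: cond_subgaussian_def)
  have "(\<integral>\<^sup>+\<omega>. ennreal (indicator B (X \<omega>) * exp (t * \<epsilon> \<omega>)) \<partial>M) =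
      (\<integral>\<^sup>+\<omega>. indicator B (X \<omega>) * ennreal (exp (t * \<epsilon> \<omega>)) \<partial>M)"
    by (intro nn_integral_cong) (auto simp: indicator_def)
  also have "\<dots> = (\<integral>\<^sup>+\<omega>. indicator B (X \<omega>) * nn_cond_exp M (gen_by M X) (\<lambda>\<omega>. ennreal (exp (t * \<epsilon> \<omega>))) \<omega> \<partial>M)"
    by (intro F.nn_cond_exp_intg[symmetric] measurable_gen_by) auto
  also have "\<dots> \<le> (\<integral>\<^sup>+\<omega>. ennreal (exp (t\<^sup>2 * s / 2)) * indicator {\<omega>\<in>space M. X \<omega> \<in> B} \<omega> \<partial>M)"
  proof (rule nn_integral_mono_AE)
    have "AE \<omega> in M. nn_cond_exp M (gen_by M X) (\<lambda>\<omega>. ennreal (exp (t * \<epsilon> \<omega>))) \<omega> \<le> ennreal (exp (t\<^sup>2 * s / 2))"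
      using sub by (auto simp: cond_subgaussian_def)
    with AE_space show "AE \<omega> in M. indicator B (X \<omega>) * nn_cond_exp M (gen_by M X) (\<lambda>\<omega>. ennreal (exp (t * \<epsilon> \<omega>))) \<omega>
        \<le> ennreal (exp (t\<^sup>2 * s / 2)) * indicator {\<omega>\<in>space M. X \<omega> \<in> B} \<omega>"
      by eventually_elim (auto simp: indicator_def)
  qed
  also have "\<dots> = ennreal (exp (t\<^sup>2 * s / 2) * prob {\<omega>\<in>space M. X \<omega> \<in> B})"
    by (subst nn_integral_cmult_indicator) (auto simp: emeasure_eq_measure ennreal_mult)
  finally have le: "(\<integral>\<^sup>+\<omega>. ennreal (indicator B (X \<omega>) * exp (t * \<epsilon> \<omega>)) \<partial>M) \<le>
      ennreal (exp (t\<^sup>2 * s / 2) * prob {\<omega>\<in>space M. X \<omega> \<in> B})" .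
  show ?int
    by (rule integrableI_bounded) (use le in \<open>auto simp: le_less_trans\<close>)
  then show ?le
    using le by (subst (asm) nn_integral_eq_integral) auto
qed

text \<open>Integrating \<open>(t * \<epsilon>)\<^sup>2 \<le> exp (t * \<epsilon>) + exp (- t *
  \<epsilon>) - 2\<close> over the event bounds the second moment by the exponential moments.
  Dividing by \<open>t\<^sup>2\<close> and letting \<open>t\<close> tend to 0 leaves the factor
  \<open>s\<close>.\<close>

lemma (in prob_space) cond_subgaussian_variance_on_le:
  fixes X :: "'a \<Rightarrow> 'b::topological_space"
  assumes X[measurable]: "X \<in> borel_measurable M" and sub: "cond_subgaussian M X \<epsilon> s" and B[measurable]: "B \<in> sets borel"
  shows "integrable M (\<lambda>\<omega>. indicator B (X \<omega>) * (\<epsilon> \<omega>)\<^sup>2)" (is ?int)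
    and "expectation (\<lambda>\<omega>. indicator B (X \<omega>) * (\<epsilon> \<omega>)\<^sup>2) \<le> s * prob {\<omega>\<in>space M. X \<omega> \<in> B}" (is ?le)
proof -
  have [measurable]: "\<epsilon> \<in> borel_measurable M" using sub by (auto simp: cond_subgaussian_def)
  note mgf = cond_subgaussian_mgf_on[OF X sub B]
  let ?P = "prob {\<omega>\<in>space M. X \<omega> \<in> B}"
  \<comment> \<open>This is \<open>2 * (cosh (t * \<epsilon>) - 1)\<close> restricted to the event.
    Already \<open>D 1\<close> dominates the square and makes it integrable.\<close>
  define D where "D t \<omega> = indicator B (X \<omega>) * exp (t * \<epsilon> \<omega>) + indicator B (X \<omega>) * exp (- t * \<epsilon> \<omega>) -
      2 * indicator {\<omega>\<in>space M. X \<omega> \<in> B} \<omega>" for t \<omega>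
  have D_int: "integrable M (D t)" for t
    unfolding D_def by (intro Bochner_Integration.integrable_diff Bochner_Integration.integrable_add mgf integrable_mult_right)
      (auto simp: emeasure_eq_measure)
  have D_ge: "t\<^sup>2 * (indicator B (X \<omega>) * (\<epsilon> \<omega>)\<^sup>2) \<le> D t \<omega>" if "\<omega> \<in> space M" for t \<omega>
    using cosh_ge_quadratic[of "t * \<epsilon> \<omega>"] that
    by (auto simp: D_def indicator_def cosh_def power_mult_distrib)
  show int: ?int
    by (rule Bochner_Integration.integrable_bound[OF D_int[of 1]]) (use D_ge[of _ 1] in \<open>auto intro!: AE_I2 intro: order_trans[OF _ abs_ge_self]\<close>)
  have "expectation (D t) \<le> 2 * (exp (t\<^sup>2 * s / 2) - 1) * ?P" for t
  proof -
    have "expectation (D t) = expectation (\<lambda>\<omega>. indicator B (X \<omega>) * exp (t * \<epsilon> \<omega>)) +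
        expectation (\<lambda>\<omega>. indicator B (X \<omega>) * exp (- t * \<epsilon> \<omega>)) - 2 * ?P"
      unfolding D_def using mgf(1)[of t] mgf(1)[of "-t"] by (simp add: emeasure_eq_measure)
    also have "\<dots> \<le> 2 * (exp (t\<^sup>2 * s / 2) - 1) * ?P"
      using mgf(2)[of t] mgf(2)[of "-t"] by (simp add: algebra_simps)
    finally show ?thesis .
  qed
  moreover have "t\<^sup>2 * expectation (\<lambda>\<omega>. indicator B (X \<omega>) * (\<epsilon> \<omega>)\<^sup>2) \<le> expectation (D t)" for t
  proof -
    have "expectation (\<lambda>\<omega>. t\<^sup>2 * (indicator B (X \<omega>) * (\<epsilon> \<omega>)\<^sup>2)) \<le> expectation (D t)"
      by (intro integral_mono integrable_mult_right int D_int D_ge)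
    then show ?thesis by simp
  qed
  ultimately have bd: "t\<^sup>2 * expectation (\<lambda>\<omega>. indicator B (X \<omega>) * (\<epsilon> \<omega>)\<^sup>2) \<le> 2 * (exp (t\<^sup>2 * s / 2) - 1) * ?P" for t
    using order_trans by blast
  \<comment> \<open>With \<open>u = t\<^sup>2\<close> the limit becomes a first derivative at
    0.\<close>
  have "((\<lambda>u. exp (u * s / 2)) has_real_derivative s / 2) (at 0)"
    by (auto intro!: derivative_eq_intros)
  then have "((\<lambda>u. (exp (u * s / 2) - 1) / u) \<longlongrightarrow> s / 2) (at 0)"
    by (simp add: DERIV_def)
  then have "((\<lambda>u. 2 * ((exp (u * s / 2) - 1) / u) * ?P) \<longlongrightarrow> 2 * (s / 2) * ?P) (at 0)"
    by (intro tendsto_mult tendsto_const)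
  then have lim: "((\<lambda>u. 2 * ((exp (u * s / 2) - 1) / u) * ?P) \<longlongrightarrow> s * ?P) (at_right 0)"
    using tendsto_mono[OF at_le[OF subset_UNIV]] by fastforce
  show ?le
  proof (rule tendsto_lowerbound[OF lim])
    show "\<forall>\<^sub>F u in at_right 0. expectation (\<lambda>\<omega>. indicator B (X \<omega>) * (\<epsilon> \<omega>)\<^sup>2) \<le> 2 * ((exp (u * s / 2) - 1) / u) * ?P"
      using eventually_at_right_less[of 0]
    proof eventually_elim
      case (elim u)
      then show ?case using bd[of "sqrt u"] by (simp add: field_simps)
    qed
  qed simp
qed

text \<open>The upper bounds over \<open>B\<close> and over its complement add up to
  \<open>s\<close>, which by \<open>var\<close> is the full second moment. Hence neither of them can
  be strict. This supplies the bound from below that sub-Gaussianity alone does not give.\<close>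

lemma (in prob_space) cond_subgaussian_variance_on_eq:
  fixes X :: "'a \<Rightarrow> 'b::topological_space"
  assumes X[measurable]: "X \<in> borel_measurable M" and sub: "cond_subgaussian M X \<epsilon> s" and B[measurable]: "B \<in> sets borel"
    and var: "expectation (\<lambda>\<omega>. (\<epsilon> \<omega>)\<^sup>2) = s"
  shows "expectation (\<lambda>\<omega>. indicator B (X \<omega>) * (\<epsilon> \<omega>)\<^sup>2) = s * prob {\<omega>\<in>space M. X \<omega> \<in> B}"
proof -
  have B': "- B \<in> sets borel" using B by auto
  note on = cond_subgaussian_variance_on_le[OF X sub B] and off = cond_subgaussian_variance_on_le[OF X sub B']
  have "s = expectation (\<lambda>\<omega>. indicator B (X \<omega>) * (\<epsilon> \<omega>)\<^sup>2 + indicator (- B) (X \<omega>) * (\<epsilon> \<omega>)\<^sup>2)"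
    unfolding var[symmetric] by (intro Bochner_Integration.integral_cong) (auto simp: indicator_def)
  also have "\<dots> = expectation (\<lambda>\<omega>. indicator B (X \<omega>) * (\<epsilon> \<omega>)\<^sup>2) + expectation (\<lambda>\<omega>. indicator (- B) (X \<omega>) * (\<epsilon> \<omega>)\<^sup>2)"
    using on off by simp
  finally have "expectation (\<lambda>\<omega>. indicator B (X \<omega>) * (\<epsilon> \<omega>)\<^sup>2) +
      expectation (\<lambda>\<omega>. indicator (- B) (X \<omega>) * (\<epsilon> \<omega>)\<^sup>2) = s" by simp
  moreover have "prob {\<omega>\<in>space M. X \<omega> \<in> - B} = 1 - prob {\<omega>\<in>space M. X \<omega> \<in> B}"
    using prob_neg[of "\<lambda>\<omega>. X \<omega> \<in> B"] by simp
  ultimately have "s \<le> expectation (\<lambda>\<omega>. indicator B (X \<omega>) * (\<epsilon> \<omega>)\<^sup>2) + (s - s * prob {\<omega>\<in>space M. X \<omega> \<in> B})"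
    using off(2) by (simp add: right_diff_distrib)
  then show ?thesis using on(2) by linarith
qed

text \<open>A bounded function of \<open>X\<close> may be moved inside the conditional expectation
  of \<open>\<epsilon>\<close>, which is zero.\<close>

lemma (in prob_space) cond_subgaussian_orthogonal:
  fixes X :: "'a \<Rightarrow> 'b::topological_space"
  assumes X[measurable]: "X \<in> borel_measurable M" and sub: "cond_subgaussian M X \<epsilon> s"
    and f[measurable]: "f \<in> borel_measurable borel" and bd: "\<And>x. \<bar>f x\<bar> \<le> K"
  shows "integrable M (\<lambda>\<omega>. f (X \<omega>) * \<epsilon> \<omega>)" (is ?int) and "expectation (\<lambda>\<omega>. f (X \<omega>) * \<epsilon> \<omega>) = 0" (is ?eq)
proof -
  interpret F: finite_measure_subalgebra M "gen_by M X" by (rule gen_by_subalgebra[OF X])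
  have \<epsilon>: "integrable M \<epsilon>" and zero: "AE \<omega> in M. real_cond_exp M (gen_by M X) \<epsilon> \<omega> = 0"
    using sub by (auto simp: cond_subgaussian_def)
  have [measurable]: "\<epsilon> \<in> borel_measurable M" using \<epsilon> by auto
  show int: ?int
    by (rule Bochner_Integration.integrable_bound[OF integrable_mult_right[OF \<epsilon>, of K]])
       (use bd in \<open>auto simp: abs_mult intro!: AE_I2 mult_right_mono intro: order_trans[OF _ abs_ge_self]\<close>)
  have "expectation (\<lambda>\<omega>. f (X \<omega>) * \<epsilon> \<omega>) = expectation (\<lambda>\<omega>. f (X \<omega>) * real_cond_exp M (gen_by M X) \<epsilon> \<omega>)"
    by (intro F.real_cond_exp_intg(2)[symmetric] int measurable_gen_by) auto
  also have "\<dots> = expectation (\<lambda>\<omega>. 0)"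
    using zero by (intro integral_cong_AE) auto
  finally show ?eq by simp
qed

section \<open>Uniform design: integrals and residual moments on a box\<close>

lemma cbox_cart_content:
  fixes h :: "real ^ 'd"
  assumes "\<And>k. 0 \<le> h $ k"
  shows "measure lborel (cbox 0 h) = (\<Prod>k\<in>UNIV. h $ k)"
  using assms by (subst content_cbox_cart) (auto simp: interval_ne_empty_cart)

text \<open>The reflection \<open>x \<mapsto> h - x\<close> preserves Lebesgue measure and the box,
  and it turns the coordinate sum into the sum of the side lengths minus itself. So the integral
  equals a constant minus itself.\<close>

lemma integral_coordinate_sum_box:
  fixes h :: "real ^ 'd::finite"
  assumes h: "\<And>k. 0 \<le> h $ k"
  shows "integral\<^sup>L lborel (\<lambda>x. indicator (cbox 0 h) x * (\<Sum>k\<in>UNIV. x $ k)) =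
    (\<Sum>k\<in>UNIV. h $ k) / 2 * measure lborel (cbox 0 h)"
proof -
  let ?f = "\<lambda>x::real^'d. indicator (cbox 0 h) x * (\<Sum>k\<in>UNIV. x $ k) :: real"
  have int: "integrable lborel ?f"
    using borel_integrable_compact[of "cbox 0 h" "\<lambda>x. \<Sum>k\<in>UNIV. x $ k"]
    by (simp add: continuous_intros)
  have int1: "integrable lborel (indicator (cbox 0 h) :: real^'d \<Rightarrow> real)"
    using emeasure_lborel_cbox_finite[of 0 h] by (intro integrable_real_indicator) auto
  have lb: "lborel = distr lborel borel (\<lambda>x::real^'d. h - x)"
    using lborel_affine[of "-1" h] by (simp add: density_1)
  have mem: "h - x \<in> cbox 0 h \<longleftrightarrow> x \<in> cbox 0 h" for x
    by (auto simp: mem_box_cart)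
  have "integral\<^sup>L lborel ?f = integral\<^sup>L lborel (\<lambda>x. ?f (h - x))"
    by (subst lb, subst integral_distr) auto
  also have "\<dots> = integral\<^sup>L lborel (\<lambda>x. (\<Sum>k\<in>UNIV. h $ k) * indicator (cbox 0 h) x - ?f x)"
    by (intro Bochner_Integration.integral_cong) (auto simp: indicator_def mem sum_subtractf)
  also have "\<dots> = (\<Sum>k\<in>UNIV. h $ k) * measure lborel (cbox 0 h) - integral\<^sup>L lborel ?f"
    using int int1 by simp
  finally show ?thesis by simp
qed

text \<open>The cube has volume one, so the law of \<open>X\<close> has the indicator of the cube as
  its density, and \<open>supp\<close> absorbs that indicator.\<close>

lemma expectation_uniform_unit_cube:
  fixes X :: "'a \<Rightarrow> real ^ 'd::finite" and f :: "real ^ 'd \<Rightarrow> real"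
  assumes [measurable]: "X \<in> borel_measurable M" and law: "distr M borel X = uniform_measure lborel unit_cube"
    and [measurable]: "f \<in> borel_measurable borel" and supp: "\<And>x. x \<notin> unit_cube \<Longrightarrow> f x = 0"
  shows "integral\<^sup>L M (\<lambda>\<omega>. f (X \<omega>)) = integral\<^sup>L lborel f"
proof -
  have cube: "measure lborel (unit_cube :: (real^'d) set) = 1"
    unfolding unit_cube_def by (subst cbox_cart_content) auto
  have ecube: "emeasure lborel (unit_cube :: (real^'d) set) = 1"
    using cube emeasure_lborel_cbox_finite[of "0::real^'d" 1]
    by (simp add: unit_cube_def emeasure_eq_ennreal_measure)
  have [measurable]: "unit_cube \<in> sets (borel :: (real^'d) measure)" by (simp add: unit_cube_def)
  have "integral\<^sup>L M (\<lambda>\<omega>. f (X \<omega>)) = integral\<^sup>L (uniform_measure lborel unit_cube) f"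
    unfolding law[symmetric] by (simp add: integral_distr)
  also have "uniform_measure lborel unit_cube = density lborel (\<lambda>x::real^'d. ennreal (indicator unit_cube x))"
    unfolding uniform_measure_def ecube by (simp add: ennreal_indicator divide_ennreal_def)
  also have "integral\<^sup>L \<dots> f = integral\<^sup>L lborel (\<lambda>x. indicator unit_cube x * f x)"
    by (subst integral_density) auto
  also have "\<dots> = integral\<^sup>L lborel f"
    using supp by (intro Bochner_Integration.integral_cong) (auto simp: indicator_def)
  finally show ?thesis .
qed

text \<open>On the box, \<open>Y - m\<close> is the sum of \<open>g (X \<omega>) - m\<close> and the
  noise. The first part is centered because \<open>m\<close> is the mean of the coordinate sum over
  the box; the noise is orthogonal to it. The second moment is therefore the variation of
  \<open>g\<close> over the box plus \<open>s * p\<close>, and dropping the former gives the last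
  claim.\<close>

lemma (in prob_space) residual_moments_on_box:
  fixes X :: "'a \<Rightarrow> real ^ 'd::finite" and h :: "real ^ 'd"
  assumes X[measurable]: "X \<in> borel_measurable M" and law: "distr M borel X = uniform_measure lborel unit_cube"
    and sub: "cond_subgaussian M X (\<lambda>\<omega>. Y \<omega> - g (X \<omega>)) s"
    and var: "expectation (\<lambda>\<omega>. (Y \<omega> - g (X \<omega>))\<^sup>2) = s"
    and g[measurable]: "g \<in> borel_measurable borel" and g_eq: "\<And>x. x \<in> unit_cube \<Longrightarrow> g x = (\<Sum>k\<in>UNIV. x $ k)"
    and h: "\<And>k. 0 \<le> h $ k" and box: "cbox 0 h \<subseteq> unit_cube"
  defines "m \<equiv> (\<Sum>k\<in>UNIV. h $ k) / 2" and "p \<equiv> measure lborel (cbox 0 h)"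
  shows "expectation (\<lambda>\<omega>. indicator (cbox 0 h) (X \<omega>)) = p"
    and "expectation (\<lambda>\<omega>. indicator (cbox 0 h) (X \<omega>) * (Y \<omega> - m)) = 0"
    and "integrable M (\<lambda>\<omega>. (indicator (cbox 0 h) (X \<omega>) * (Y \<omega> - m))\<^sup>2)"
    and "expectation (\<lambda>\<omega>. (indicator (cbox 0 h) (X \<omega>) * (Y \<omega> - m))\<^sup>2) \<ge> s * p"
proof -
  define \<epsilon> where "\<epsilon> \<omega> = Y \<omega> - g (X \<omega>)" for \<omega>
  have sub: "cond_subgaussian M X \<epsilon> s" and var: "expectation (\<lambda>\<omega>. (\<epsilon> \<omega>)\<^sup>2) = s"
    using sub var unfolding \<epsilon>_def by auto
  define G where "G x = indicator (cbox 0 h) x * (g x - m)" for x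
  have G_meas[measurable]: "G \<in> borel_measurable borel" unfolding G_def by measurable
  \<comment> \<open>The coordinate formula for \<open>g\<close> holds on the cube only; the
    inclusion of the box in the cube makes it available here.\<close>
  have G_eq: "G x = indicator (cbox 0 h) x * (\<Sum>k\<in>UNIV. x $ k) - m * indicator (cbox 0 h) x" for x
    using box g_eq[of x] by (auto simp: G_def indicator_def)
  have G_bd: "\<bar>G x\<bar> \<le> m" for x
  proof (cases "x \<in> cbox 0 h")
    case True
    then have "0 \<le> (\<Sum>k\<in>UNIV. x $ k)" "(\<Sum>k\<in>UNIV. x $ k) \<le> (\<Sum>k\<in>UNIV. h $ k)"
      by (auto simp: mem_box_cart intro!: sum_nonneg sum_mono)
    moreover have "G x = (\<Sum>k\<in>UNIV. x $ k) - m" using True by (simp add: G_eq)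
    ultimately show ?thesis unfolding m_def by linarith
  qed (use h in \<open>auto simp: G_eq m_def sum_nonneg\<close>)
  have V_in: "indicator (cbox 0 h) x = (0::real)" if "x \<notin> unit_cube" for x
    using that box by (auto simp: indicator_def)
  have V_int: "integrable lborel (indicator (cbox 0 h) :: real^'d \<Rightarrow> real)"
    using emeasure_lborel_cbox_finite[of 0 h] by (intro integrable_real_indicator) auto
  show Ep: "expectation (\<lambda>\<omega>. indicator (cbox 0 h) (X \<omega>)) = p"
    using expectation_uniform_unit_cube[OF X law, of "indicator (cbox 0 h)"] V_in by (simp add: p_def)
  have sum_int: "integrable lborel (\<lambda>x. indicator (cbox 0 h) x * (\<Sum>k\<in>UNIV. x $ k))"
    using borel_integrable_compact[of "cbox 0 h" "\<lambda>x. \<Sum>k\<in>UNIV. x $ k"]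
    by (simp add: continuous_intros)
  have "expectation (\<lambda>\<omega>. G (X \<omega>)) = integral\<^sup>L lborel G"
    using V_in by (intro expectation_uniform_unit_cube X law) (auto simp: G_eq)
  also have "\<dots> = 0"
    unfolding G_eq[abs_def] using sum_int V_int integral_coordinate_sum_box[OF h] by (simp add: m_def p_def)
  finally have EG: "expectation (\<lambda>\<omega>. G (X \<omega>)) = 0" .
  have G_int: "integrable M (\<lambda>\<omega>. G (X \<omega>))"
    by (rule integrable_const_bound[of _ m]) (auto simp: G_bd)
  have G2_int: "integrable M (\<lambda>\<omega>. (G (X \<omega>))\<^sup>2)"
    by (rule integrable_const_bound[of _ "m\<^sup>2"]) (use power_mono[OF G_bd, of _ 2] in auto)
  have decomp: "indicator (cbox 0 h) (X \<omega>) * (Y \<omega> - m) = G (X \<omega>) + indicator (cbox 0 h) (X \<omega>) * \<epsilon> \<omega>" for \<omega>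
    by (auto simp: G_def \<epsilon>_def indicator_def)
  note orth1 = cond_subgaussian_orthogonal[OF X sub, of "indicator (cbox 0 h)" 1]
  note orthG = cond_subgaussian_orthogonal[OF X sub G_meas G_bd]
  show "expectation (\<lambda>\<omega>. indicator (cbox 0 h) (X \<omega>) * (Y \<omega> - m)) = 0"
    unfolding decomp using orth1 G_int EG by (simp add: indicator_def)
  \<comment> \<open>\<open>G\<close> already contains the indicator, so the mixed term is
    \<open>\<epsilon>\<close> times a bounded function of \<open>X\<close> and has mean
    zero.\<close>
  have decomp2: "(indicator (cbox 0 h) (X \<omega>) * (Y \<omega> - m))\<^sup>2 =
      (G (X \<omega>))\<^sup>2 + 2 * (G (X \<omega>) * \<epsilon> \<omega>) + indicator (cbox 0 h) (X \<omega>) * (\<epsilon> \<omega>)\<^sup>2" for \<omega>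
    unfolding decomp by (auto simp: G_def indicator_def power2_eq_square algebra_simps)
  have V: "cbox 0 h \<in> sets (borel :: (real^'d) measure)" by simp
  note v_int = cond_subgaussian_variance_on_le(1)[OF X sub V]
  show "integrable M (\<lambda>\<omega>. (indicator (cbox 0 h) (X \<omega>) * (Y \<omega> - m))\<^sup>2)"
    unfolding decomp2 using G2_int orthG(1) v_int by simp
  have "expectation (\<lambda>\<omega>. indicator (cbox 0 h) (X \<omega>) * (\<epsilon> \<omega>)\<^sup>2) = s * p"
  proof -
    have "prob {\<omega>\<in>space M. X \<omega> \<in> cbox 0 h} = expectation (indicator {\<omega>\<in>space M. X \<omega> \<in> cbox 0 h})"
      by simp
    also have "\<dots> = p"
      unfolding Ep[symmetric] by (intro Bochner_Integration.integral_cong) (auto simp: indicator_def)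
    finally show ?thesis using cond_subgaussian_variance_on_eq[OF X sub V var] by simp
  qed
  then have "expectation (\<lambda>\<omega>. (indicator (cbox 0 h) (X \<omega>) * (Y \<omega> - m))\<^sup>2) = expectation (\<lambda>\<omega>. (G (X \<omega>))\<^sup>2) + s * p"
    unfolding decomp2 using G2_int orthG v_int by simp
  moreover have "expectation (\<lambda>\<omega>. (G (X \<omega>))\<^sup>2) \<ge> 0" by simp
  ultimately show "expectation (\<lambda>\<omega>. (indicator (cbox 0 h) (X \<omega>) * (Y \<omega> - m))\<^sup>2) \<ge> s * p" by linarith
qed

section \<open>Balance of bias and variance, and the lower bound\<close>

text \<open>At \<open>a = root (d + 2) b\<close> both summands equal the left-hand side. The first
  increases and the second decreases in \<open>a\<close>, so one of them is always large
  enough.\<close>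

lemma bias_variance_tradeoff:
  fixes a b :: real
  assumes a: "0 < a" and b: "0 \<le> b"
  shows "(root (d + 2) b)\<^sup>2 \<le> a\<^sup>2 + b / a ^ d"
proof -
  let ?r = "root (d + 2) b"
  have r: "?r \<ge> 0" "?r ^ (d + 2) = b" using b by (auto simp del: add_2_eq_Suc')
  show ?thesis
  proof (cases "?r \<le> a")
    case True
    then have "?r\<^sup>2 \<le> a\<^sup>2" using r by (intro power_mono) auto
    then show ?thesis using a b by (smt (verit) divide_nonneg_pos zero_less_power)
  next
    case False
    then have "a ^ d * ?r\<^sup>2 \<le> ?r ^ d * ?r\<^sup>2" using a by (intro mult_right_mono power_mono) auto
    also have "\<dots> = b" using r(2) by (simp add: power_add del: add_2_eq_Suc')
    finally have "?r\<^sup>2 \<le> b / a ^ d" using a by (simp add: le_divide_eq mult.commute)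
    then show ?thesis by (smt (verit) zero_le_power2)
  qed
qed

theorem proposition10:
  "\<exists>C>0. \<forall>(M :: ('d::finite) sample_space measure) (X :: nat \<Rightarrow> 'd sample_space \<Rightarrow> real ^ 'd)
      (Y :: nat \<Rightarrow> 'd sample_space \<Rightarrow> real) (g :: real ^ 'd \<Rightarrow> real) (\<epsilon> :: 'd sample_space \<Rightarrow> real)
      (\<sigma> :: real) (n :: nat) (V :: real ^ 'd \<Rightarrow> (real ^ 'd) set) (h :: real ^ 'd) (\<gamma> :: real).
    n \<ge> 1 \<longrightarrow>
    prob_space M \<longrightarrow>
    iid_vars M (\<lambda>i \<omega>. (X i \<omega>, Y i \<omega>)) {0..n} \<longrightarrow>
    distr M borel (X 0) = uniform_measure lborel unit_cube \<longrightarrow>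
    regression_function M (X 0) (Y 0) g \<longrightarrow>
    (\<forall>x\<in>unit_cube. g x = (\<Sum>k\<in>UNIV. x $ k)) \<longrightarrow>
    \<epsilon> = (\<lambda>\<omega>. Y 0 \<omega> - g (X 0 \<omega>)) \<longrightarrow>
    cond_subgaussian M (X 0) \<epsilon> (\<sigma>\<^sup>2) \<longrightarrow>
    prob_space.expectation M (\<lambda>\<omega>. (\<epsilon> \<omega>)\<^sup>2) = \<sigma>\<^sup>2 \<longrightarrow>
    local_map V \<longrightarrow>
    V 0 = cbox 0 h \<longrightarrow>
    diameter (V 0) ^ CARD('d) / measure lborel (V 0) \<ge> \<gamma> \<longrightarrow>
    2 ^ (CARD('d) + 4) * ln 2 \<le> real n * (\<Prod>k\<in>UNIV. h $ k) \<longrightarrow>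
    sqrt (prob_space.expectation M
        (\<lambda>\<omega>. (local_estimator V n (\<lambda>i. X i \<omega>) (\<lambda>i. Y i \<omega>) 0 - g 0)\<^sup>2))
      \<ge> C * root (CARD('d) + 2) (\<gamma> * \<sigma>\<^sup>2 / real n)"
proof (intro exI[of _ "sqrt (1 / 8)"] conjI allI impI)
  \<comment> \<open>The factor 8 comes from the bias: \<open>m\<close> is at least half the
    diameter, which gives 1/4 after squaring, and the cell is hit with probability at least 1/2. The
    variance term has the better constant 1/4.\<close>
  show "0 < sqrt (1 / 8 :: real)" by simp
next
  fix M :: "'d sample_space measure" and X :: "nat \<Rightarrow> 'd sample_space \<Rightarrow> real ^ 'd"
    and Y :: "nat \<Rightarrow> 'd sample_space \<Rightarrow> real" and g :: "real ^ 'd \<Rightarrow> real" and \<epsilon> :: "'d sample_space \<Rightarrow> real"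
    and \<sigma> :: real and n :: nat and V :: "real ^ 'd \<Rightarrow> (real ^ 'd) set" and h :: "real ^ 'd" and \<gamma> :: real
  assume n: "n \<ge> 1" and "prob_space M" and iid: "iid_vars M (\<lambda>i \<omega>. (X i \<omega>, Y i \<omega>)) {0..n}"
    and law: "distr M borel (X 0) = uniform_measure lborel unit_cube"
    and reg: "regression_function M (X 0) (Y 0) g"
    and g_eq: "\<forall>x\<in>unit_cube. g x = (\<Sum>k\<in>UNIV. x $ k)"
    and \<epsilon>_eq: "\<epsilon> = (\<lambda>\<omega>. Y 0 \<omega> - g (X 0 \<omega>))"
    and sub: "cond_subgaussian M (X 0) \<epsilon> (\<sigma>\<^sup>2)"
    and var: "prob_space.expectation M (\<lambda>\<omega>. (\<epsilon> \<omega>)\<^sup>2) = \<sigma>\<^sup>2"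
    and lm: "local_map V" and V0: "V 0 = cbox 0 h"
    and \<gamma>: "diameter (V 0) ^ CARD('d) / measure lborel (V 0) \<ge> \<gamma>"
    and large: "2 ^ (CARD('d) + 4) * ln 2 \<le> real n * (\<Prod>k\<in>UNIV. h $ k)"
  interpret prob_space M by fact
  let ?A = "cbox 0 h"
  have zero_in: "(0 :: real^'d) \<in> unit_cube" by (simp add: unit_cube_def mem_box_cart)
  have box: "?A \<subseteq> unit_cube" and vol: "0 < emeasure lborel ?A"
    using lm zero_in V0 unfolding local_map_def by force+
  \<comment> \<open>No sign of the sides is assumed; positive volume makes the box nonempty, which
    forces nonnegative sides.\<close>
  have h0: "0 \<le> h $ k" for k
  proof -
    have "?A \<noteq> {}" using vol by auto
    then show ?thesis by (auto simp: interval_ne_empty_cart)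
  qed
  have p_eq: "measure lborel ?A = (\<Prod>k\<in>UNIV. h $ k)" by (rule cbox_cart_content[OF h0])
  define p where "p = (\<Prod>k\<in>UNIV. h $ k)"
  have p: "p > 0"
    using vol emeasure_lborel_cbox_finite[of 0 h] unfolding p_def p_eq[symmetric] measure_def
    by (simp add: enn2real_positive_iff)
  define m where "m = (\<Sum>k\<in>UNIV. h $ k) / 2"
  define a where "a = norm h"
  have a_eq: "diameter (V 0) = a"
    unfolding V0 a_def by (subst diameter_cbox) (auto simp: Basis_vec_def inner_axis h0)
  have a: "a > 0"
  proof -
    have "h \<noteq> 0" using p by (auto simp: p_def zero_power)
    then show ?thesis by (simp add: a_def)
  qed
  \<comment> \<open>The Euclidean norm of \<open>h\<close> is at most its l1 norm, which is
    \<open>2 * m\<close>. This compares the bias with the diameter.\<close>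
  have a_m: "a \<le> 2 * m"
    using norm_le_l1_cart[of h] h0 by (simp add: a_def m_def)
  define U where "U i \<omega> = (X i \<omega>, Y i \<omega>)" for i \<omega>
  have U: "iid_vars M U {0..n}"
    using iid unfolding U_def[abs_def] .
  then have indep0: "indep_vars (\<lambda>_. borel) U {0..n}"
    by (simp add: iid_vars_def)
  have same: "distr M borel (U i) = distr M borel (U 0)" if "i \<in> {0..n}" for i
    using U that unfolding iid_vars_def by (meson atLeastAtMost_iff le0)
  have indep: "indep_vars (\<lambda>_. borel) U {1..n}" by (rule indep_vars_subset[OF indep0]) auto
  have U_meas: "U i \<in> borel_measurable M" if "i \<in> {0..n}" for i
    using indep0 that by (auto simp: indep_vars_def)
  have X0[measurable]: "X 0 \<in> borel_measurable M"
  proof -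
    have "(\<lambda>\<omega>. fst (U 0 \<omega>)) \<in> borel_measurable M"
      by (rule measurable_compose[OF U_meas]) (auto intro!: borel_measurable_continuous_onI continuous_intros)
    then show ?thesis by (simp add: U_def)
  qed
  have g_meas: "g \<in> borel_measurable borel" using reg by (simp add: regression_function_def)
  \<comment> \<open>The assumptions on regression and noise concern the generic pair with index 0;
    equality of laws carries the moments over to the sample.\<close>
  have ident: "expectation (\<lambda>\<omega>. f (U i \<omega>)) = expectation (\<lambda>\<omega>. f (U 0 \<omega>))"
    "integrable M (\<lambda>\<omega>. f (U i \<omega>)) \<longleftrightarrow> integrable M (\<lambda>\<omega>. f (U 0 \<omega>))"
    if "i \<in> {1..n}" "f \<in> borel_measurable borel" for i and f :: "(real^'d) \<times> real \<Rightarrow> real"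
    using integral_distr[OF U_meas that(2), of i] integral_distr[OF U_meas that(2), of 0]
      integrable_distr_eq[OF U_meas that(2), of i] integrable_distr_eq[OF U_meas that(2), of 0] same[of i] that(1)
    by auto
  define B where "B = ?A \<times> (UNIV :: real set)"
  define \<phi> where "\<phi> u = indicator ?A (fst u) * (snd u - m)" for u :: "(real^'d) \<times> real"
  have B_meas: "B \<in> sets borel"
    unfolding B_def by (intro borel_Times) auto
  have \<phi>_meas: "\<phi> \<in> borel_measurable borel"
    unfolding \<phi>_def[abs_def] borel_prod[symmetric] by measurable
  have B_U: "indicator B (U i \<omega>) = (indicator ?A (X i \<omega>) :: real)" for i \<omega>
    by (auto simp: B_def U_def indicator_def)
  have \<phi>_U: "\<phi> (U i \<omega>) = indicator ?A (X i \<omega>) * (Y i \<omega> - m)" for i \<omega>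
    by (simp add: \<phi>_def U_def)
  note mom = residual_moments_on_box[OF X0 law sub[unfolded \<epsilon>_eq] var[unfolded \<epsilon>_eq] g_meas g_eq[rule_format] h0 box,
      folded m_def, unfolded p_eq, folded p_def]
  \<comment> \<open>The variance of \<open>Y\<close> given that \<open>X\<close> lies in the cell.
    It includes the variation of \<open>g\<close> there, so it is only bounded below by
    \<open>\<sigma>\<^sup>2\<close>.\<close>
  define q where "q = expectation (\<lambda>\<omega>. (\<phi> (U 0 \<omega>))\<^sup>2) / p"
  have q: "q \<ge> \<sigma>\<^sup>2"
    using mom(4) p by (simp add: q_def \<phi>_U le_divide_eq)
  have Ep: "expectation (\<lambda>\<omega>. indicator B (U i \<omega>)) = p" if "i \<in> {1..n}" for i
    using ident(1)[OF that, of "indicator B"] B_meas mom(1) by (simp add: B_U)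
  have mean: "expectation (\<lambda>\<omega>. \<phi> (U i \<omega>)) = 0" if "i \<in> {1..n}" for i
    using ident(1)[OF that \<phi>_meas] mom(2) by (simp add: \<phi>_U)
  have sq_int: "integrable M (\<lambda>\<omega>. (\<phi> (U i \<omega>))\<^sup>2)" if "i \<in> {1..n}" for i
    using ident(2)[OF that, of "\<lambda>u. (\<phi> u)\<^sup>2"] \<phi>_meas mom(3) by (simp add: \<phi>_U)
  have sq: "expectation (\<lambda>\<omega>. (\<phi> (U i \<omega>))\<^sup>2) = q * expectation (\<lambda>\<omega>. indicator B (U i \<omega>))" if "i \<in> {1..n}" for i
    using ident(1)[OF that, of "\<lambda>u. (\<phi> u)\<^sup>2"] \<phi>_meas Ep[OF that] p by (simp add: q_def)
  define N where "N \<omega> = (\<Sum>i=1..n. indicator B (U i \<omega>) :: real)" for \<omega>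
  \<comment> \<open>Here \<open>g 0 = 0\<close>. On an empty cell the estimator is 0 by the
    convention for division, which is why \<open>m\<close> comes with the factor
    \<open>of_bool\<close>.\<close>
  have est: "local_estimator V n (\<lambda>i. X i \<omega>) (\<lambda>i. Y i \<omega>) 0 - g 0 =
      m * of_bool (N \<omega> \<noteq> 0) + (\<Sum>i=1..n. \<phi> (U i \<omega>)) / N \<omega>" for \<omega>
  proof -
    have "(\<Sum>i=1..n. \<phi> (U i \<omega>)) = (\<Sum>i=1..n. Y i \<omega> * indicator ?A (X i \<omega>)) - m * N \<omega>"
      unfolding N_def B_U \<phi>_U sum_distrib_left sum_subtractf[symmetric]
      by (intro sum.cong refl) (simp add: algebra_simps)
    moreover have "local_estimator V n (\<lambda>i. X i \<omega>) (\<lambda>i. Y i \<omega>) 0 =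
        (\<Sum>i=1..n. Y i \<omega> * indicator ?A (X i \<omega>)) / N \<omega>"
      unfolding local_estimator_def V0 N_def B_U ..
    moreover have "g 0 = 0" using g_eq zero_in by simp
    ultimately show ?thesis
      by (cases "N \<omega> = 0") (simp_all only: diff_divide_distrib, simp_all)
  qed
  have fin: "finite {1..n}" by simp
  have large': "ln 2 \<le> real (card {1..n}) * p"
  proof -
    have "1 * ln 2 \<le> 2 ^ (CARD('d) + 4) * ln (2::real)" by (intro mult_right_mono) simp_all
    from order_trans[OF this large] show ?thesis by (simp add: p_def)
  qed
  have \<phi>_out: "\<phi> u = 0" if "u \<notin> B" for u
    using that by (cases u) (auto simp: \<phi>_def B_def)
  let ?R = "expectation (\<lambda>\<omega>. (local_estimator V n (\<lambda>i. X i \<omega>) (\<lambda>i. Y i \<omega>) 0 - g 0)\<^sup>2)"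
  have R: "?R = m\<^sup>2 * prob {\<omega>\<in>space M. N \<omega> \<noteq> 0} + q * expectation (\<lambda>\<omega>. 1 / N \<omega>)"
    unfolding est N_def
    by (rule second_moment_local_average[OF fin indep B_meas \<phi>_meas \<phi>_out sq_int mean sq])
  show "sqrt (1 / 8) * root (CARD('d) + 2) (\<gamma> * \<sigma>\<^sup>2 / real n) \<le> sqrt ?R"
  \<comment> \<open>As a mere lower bound, \<open>\<gamma>\<close> may be negative. Since
    \<open>root\<close> extends to negative arguments as an odd function, the left-hand side is then
    at most 0.\<close>
  proof (cases "\<gamma> \<le> 0")
    case True
    have "\<gamma> * \<sigma>\<^sup>2 / real n \<le> 0"
      using True by (intro divide_nonpos_nonneg mult_nonpos_nonneg) auto
    then have "root (CARD('d) + 2) (\<gamma> * \<sigma>\<^sup>2 / real n) \<le> root (CARD('d) + 2) 0"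
      by (intro real_root_le_mono) simp_all
    then have "sqrt (1 / 8) * root (CARD('d) + 2) (\<gamma> * \<sigma>\<^sup>2 / real n) \<le> 0"
      by (intro mult_nonneg_nonpos) simp_all
    also have "0 \<le> sqrt ?R" by simp
    finally show ?thesis .
  next
    case False
    define b where "b = \<gamma> * \<sigma>\<^sup>2 / real n"
    have b: "b \<ge> 0" using False by (simp add: b_def)
    have half: "prob {\<omega>\<in>space M. N \<omega> \<noteq> 0} \<ge> 1 / 2"
      unfolding N_def by (rule prob_some_indep_event_ge_half[OF fin indep B_meas Ep large'])
    have inv: "expectation (\<lambda>\<omega>. 1 / N \<omega>) \<ge> 1 / (4 * (real n * p))"
      using expectation_inverse_count_ge[OF fin indep B_meas Ep large'] unfolding N_def by simp
    have "a\<^sup>2 \<le> (2 * m)\<^sup>2" using a a_m by (intro power_mono) auto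
    then have "a\<^sup>2 / 8 \<le> m\<^sup>2 * (1 / 2)" by (simp add: power_mult_distrib)
    also have "\<dots> \<le> m\<^sup>2 * prob {\<omega>\<in>space M. N \<omega> \<noteq> 0}"
      using half by (intro mult_left_mono) auto
    finally have bias: "a\<^sup>2 / 8 \<le> m\<^sup>2 * prob {\<omega>\<in>space M. N \<omega> \<noteq> 0}" .
    \<comment> \<open>The shape condition trades the volume in the variance for a power of the
      diameter, so that both error terms depend on \<open>a\<close> alone.\<close>
    have "\<gamma> * p \<le> a ^ CARD('d)"
      using \<gamma> p unfolding a_eq by (simp add: V0 p_eq flip: p_def) (simp add: le_divide_eq)
    then have "\<gamma> / a ^ CARD('d) \<le> 1 / p" using a p by (simp add: field_simps)
    then have "\<sigma>\<^sup>2 / real n * (\<gamma> / a ^ CARD('d)) \<le> \<sigma>\<^sup>2 / real n * (1 / p)"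
      by (intro mult_left_mono) auto
    then have "b / a ^ CARD('d) \<le> \<sigma>\<^sup>2 / real n * (1 / p)" by (simp add: b_def mult.commute)
    \<comment> \<open>The constant 4 is relaxed to 8 to match the bias term.\<close>
    then have "(b / a ^ CARD('d)) / 8 \<le> (\<sigma>\<^sup>2 / real n * (1 / p)) / 4"
      using p by (intro frac_le) simp_all
    also have "\<dots> = \<sigma>\<^sup>2 * (1 / (4 * (real n * p)))" by simp
    also have "\<dots> \<le> q * expectation (\<lambda>\<omega>. 1 / N \<omega>)"
      using q inv p by (intro mult_mono) (auto intro: order_trans[OF zero_le_power2])
    finally have variance: "(b / a ^ CARD('d)) / 8 \<le> q * expectation (\<lambda>\<omega>. 1 / N \<omega>)" .
    have "(root (CARD('d) + 2) b)\<^sup>2 / 8 \<le> (a\<^sup>2 + b / a ^ CARD('d)) / 8"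
      using bias_variance_tradeoff[OF a b] by (rule divide_right_mono) simp
    also have "\<dots> \<le> ?R"
      unfolding R add_divide_distrib by (rule add_mono[OF bias variance])
    finally have "(root (CARD('d) + 2) b)\<^sup>2 / 8 \<le> ?R" .
    then have "(sqrt (1 / 8) * root (CARD('d) + 2) b)\<^sup>2 \<le> ?R"
      by (simp only: power_mult_distrib) simp
    then show ?thesis unfolding b_def by (rule real_le_rsqrt)
  qed
qed

end
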